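(* Let $q>0$ and $a>1$, and let $x_0=x_0(q)$ be the unique positive zero of the $q$-digamma function $\psi_q$. Then the inequality $$\left[\psi_{q}(x)\right]^{\frac{1}{a}}\left[\psi_{q}(y)\right]^{1-\frac{1}{a}}\leq\psi_{q}\left(\frac{x}{a}+\left(1-\frac{1}{a}\right)y\right)$$ holds for all $x>x_0$ and $y>x_{0}$. In particular, the inequality $$\left[\psi_{q}(2)\right]^{a-1}\leq\frac{\left[\psi_{q}(u+1)\right]^{a}}{\psi_{q}\left(a(u-1)+2\right)}$$ holds for all $a>1$ and $u>\frac{-2}{a}+1$.
   Context: For $x>0$ the $q$-gamma function is $$\Gamma_q(x)=(1-q)^{1-x}\prod_{j=0}^{\infty}\frac{1-q^{j+1}}{1-q^{j+x}}\quad (0<q<1),$$ $$\Gamma_q(x)=(q-1)^{1-x}q^{\frac{x(x-1)}{2}}\prod_{j=0}^{\infty}\frac{1-q^{-(j+1)}}{1-q^{-(j+x)}}\quad (q>1),$$ and for $q=1$ it is understood as the limit as $q\to 1$, i.e. $\Gamma_1=\Gamma$ (Euler's gamma function). The $q$-digamma function is $\psi_q(x)=\Gamma_q'(x)/\Gamma_q(x)$ for $x>0$. It is known that for each $q>0$ the function $\psi_q$ has a uniquely determined positive zero, denoted $x_0=x_0(q)$, and $x_0\in(1,2)$.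
   Formalization: The second inequality is proved under the extra condition a(u-1)+2 > x_0, i.e. u > (x_0-2)/a+1; with only u > -2/a+1 it is false, since for a(u-1)+2 slightly below x_0 the right side is negative and the left side positive. *)

theory Defs
  imports "HOL-Analysis.Analysis"
begin

text \<open>
  The definitions are meant for \<open>q > 0\<close> and \<open>x > 0\<close>. There, both infinite products
  converge and all their factors are nonzero. The case \<open>q = 1\<close> is the limit
  as \<open>q\<close> tends to 1, i.e. Euler's Gamma function.
\<close>

definition q_gamma :: "real \<Rightarrow> real \<Rightarrow> real" where
  "q_gamma q x =
     (if q = 1 then Gamma x
      else if q < 1 then
        (1 - q) powr (1 - x) *
        (\<Prod>j. (1 - q powr (real j + 1)) / (1 - q powr (real j + x)))
      else
        (q - 1) powr (1 - x) * q powr (x * (x - 1) / 2) *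
        (\<Prod>j. (1 - q powr (- (real j + 1))) / (1 - q powr (- (real j + x)))))"

definition q_digamma :: "real \<Rightarrow> real \<Rightarrow> real" where
  "q_digamma q x = deriv (q_gamma q) x / q_gamma q x"

definition q_digamma_zero :: "real \<Rightarrow> real" where
  "q_digamma_zero q = (THE x. x > 0 \<and> q_digamma q x = 0)"

end

theory Submission
  imports Defs
begin

text \<open>
  For every \<open>q > 0\<close> the function \<open>\<psi>\<^sub>q\<close> is strictly increasing and concave on the positive reals.
  On \<open>x > x\<^sub>0\<close> it is positive, so Young's inequality (the weighted arithmetic-geometric mean
  inequality) bounds the geometric mean of \<open>\<psi>\<^sub>q(x)\<close> and \<open>\<psi>\<^sub>q(y)\<close> by their arithmetic mean, and
  concavity bounds that by the value at the mean point. The second inequality is the first one at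
  \<open>a (u - 1) + 2\<close> and \<open>2\<close>, whose mean with weights \<open>1/a\<close> and \<open>1 - 1/a\<close> is \<open>u + 1\<close>; it uses
  \<open>x\<^sub>0 < 2\<close>.

  Monotonicity and concavity come from the logarithm of the product. For \<open>q \<noteq> 1\<close> let
  \<open>p = min q (1/q) < 1\<close>. Then \<open>ln \<Gamma>\<^sub>q\<close> is a polynomial in \<open>x\<close> plus the series of
  \<open>ln (1 - p\<^bsup>j+1\<^esup>) - ln (1 - p\<^bsup>j+x\<^esup>)\<close>. Its termwise derivative is a series of translates of
  \<open>t \<mapsto> p\<^bsup>t\<^esup> ln p / (1 - p\<^bsup>t\<^esup>)\<close>, which is strictly increasing and concave: \<open>p\<^bsup>t\<^esup> / (1 - p\<^bsup>t\<^esup>)\<close> is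
  decreasing and convex, and \<open>ln p < 0\<close>. The polynomial contributes a constant, and for \<open>q > 1\<close>
  also \<open>x ln q\<close>. For \<open>q = 1\<close> both properties follow from the signs of the polygamma functions.

  The zero \<open>x\<^sub>0\<close> exists and lies in \<open>(1, 2)\<close> by Rolle's theorem, as \<open>\<Gamma>\<^sub>q(1) = \<Gamma>\<^sub>q(2) = 1\<close>: for
  \<open>q \<noteq> 1\<close> the product is trivial at 1 and telescopes at 2. Strict monotonicity makes it unique.
\<close>

section \<open>The summand of the logarithmic derivative\<close>

definition log_factor_deriv :: "real \<Rightarrow> real \<Rightarrow> real" where
  "log_factor_deriv p t = ln p * p powr t / (1 - p powr t)"

lemma powr_lt_one:
  fixes p t :: real
  assumes "0 < p" "p < 1" "0 < t"
  shows "p powr t < 1"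
  using powr_less_mono'[of p 0 t] assms by simp

lemma DERIV_log_factor:
  fixes p c j t :: real
  assumes "0 < p" "p < 1" "0 < j + t"
  shows "((\<lambda>t. c - ln (1 - p powr (j + t))) has_real_derivative log_factor_deriv p (j + t)) (at t)"
  unfolding log_factor_deriv_def
  using assms powr_lt_one[OF assms]
  by (auto intro!: derivative_eq_intros simp: field_simps)

lemma strict_mono_log_factor_deriv:
  fixes p s t :: real
  assumes "0 < p" "p < 1" "0 < s" "s < t"
  shows "log_factor_deriv p s < log_factor_deriv p t"
proof -
  have less: "p powr t < p powr s" "p powr s < 1"
    using powr_less_mono'[of p s t] powr_lt_one[of p s] assms by auto
  have "p powr t / (1 - p powr t) < p powr s / (1 - p powr s)"
    using less by (simp add: field_simps)
  moreover have "ln p < 0" using assms by simp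
  ultimately show ?thesis
    unfolding log_factor_deriv_def by (metis mult_strict_left_mono_neg times_divide_eq_right)
qed

text \<open>
  Each differentiation of a function of \<open>p\<^bsup>t\<^esup>\<close> brings out a factor \<open>ln p\<close>, so the second
  derivative has the sign of \<open>(ln p)\<^sup>3\<close>.
\<close>

lemma concave_log_factor_deriv:
  fixes p :: real
  assumes "0 < p" "p < 1"
  shows "concave_on {0<..} (log_factor_deriv p)"
proof (rule f''_le0_imp_concave)
  fix t :: real
  assume "t \<in> {0<..}"
  then have t: "p powr t < 1" using powr_lt_one assms by simp
  show "(log_factor_deriv p has_real_derivative (ln p)\<^sup>2 * p powr t / (1 - p powr t)\<^sup>2) (at t)"
    unfolding log_factor_deriv_def
    using t assms
    by (auto intro!: derivative_eq_intros simp: divide_simps power2_eq_square)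
       (auto simp: algebra_simps)
  show "((\<lambda>t. (ln p)\<^sup>2 * p powr t / (1 - p powr t)\<^sup>2) has_real_derivative
          (ln p)^3 * (p powr t * (1 + p powr t) / (1 - p powr t)^3)) (at t)"
    using t assms
    by (auto intro!: derivative_eq_intros simp: divide_simps power2_eq_square power3_eq_cube)
       (auto simp: algebra_simps)
  have "(ln p)^3 \<le> 0" using assms by (simp add: power_le_zero_eq)
  then show "(ln p)^3 * (p powr t * (1 + p powr t) / (1 - p powr t)^3) \<le> 0"
    using t by (intro mult_nonpos_nonneg divide_nonneg_nonneg mult_nonneg_nonneg) auto
qed auto

text \<open>A geometric majorant, uniform on \<open>[d, \<infinity>)\<close>, for the Weierstrass test.\<close>

lemma abs_log_factor_deriv_le:
  fixes p d x :: real
  assumes "0 < p" "p < 1" "0 < d" "d \<le> x"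
  shows "\<bar>log_factor_deriv p (real j + x)\<bar> \<le> \<bar>ln p\<bar> / (1 - p powr d) * p ^ j"
proof -
  have p: "p powr (real j + x) \<le> p ^ j"
    using powr_mono'[of "real j" "real j + x" p] assms by (simp add: powr_realpow)
  have q: "p powr (real j + x) \<le> p powr d"
    using assms by (intro powr_mono') auto
  have d: "p powr d < 1" using powr_lt_one assms by simp
  have "\<bar>log_factor_deriv p (real j + x)\<bar> = \<bar>ln p\<bar> * p powr (real j + x) / (1 - p powr (real j + x))"
    unfolding log_factor_deriv_def using q d by (simp add: abs_mult)
  also have "\<dots> \<le> \<bar>ln p\<bar> * p ^ j / (1 - p powr d)"
    using p q d assms by (intro frac_le mult_left_mono mult_nonneg_nonneg) auto
  finally show ?thesis by simp
qed

lemma summable_log_factor_deriv: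
  fixes p x :: real
  assumes "0 < p" "p < 1" "0 < x"
  shows "summable (\<lambda>j. log_factor_deriv p (real j + x))"
proof (rule summable_comparison_test')
  show "summable (\<lambda>j. \<bar>ln p\<bar> / (1 - p powr x) * p ^ j)"
    using assms by (intro summable_mult summable_geometric) auto
  show "norm (log_factor_deriv p (real j + x)) \<le> \<bar>ln p\<bar> / (1 - p powr x) * p ^ j" for j
    unfolding real_norm_def using assms by (intro abs_log_factor_deriv_le) auto
qed

section \<open>The logarithm of the product\<close>

definition log_q_prod :: "real \<Rightarrow> real \<Rightarrow> real" where
  "log_q_prod p x = (\<Sum>j. ln (1 - p powr (real j + 1)) - ln (1 - p powr (real j + x)))"

definition log_q_prod_deriv :: "real \<Rightarrow> real \<Rightarrow> real" where
  "log_q_prod_deriv p x = (\<Sum>j. log_factor_deriv p (real j + x))"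

text \<open>
  All terms of the series vanish at \<open>x = 1\<close>, so uniform convergence of the derivatives alone gives
  both its convergence and its termwise differentiability.
\<close>

lemma
  fixes p x :: real
  assumes p: "0 < p" "p < 1" and x: "0 < x"
  shows summable_log_q_prod:
      "summable (\<lambda>j. ln (1 - p powr (real j + 1)) - ln (1 - p powr (real j + x)))"
    and DERIV_log_q_prod: "(log_q_prod p has_real_derivative log_q_prod_deriv p x) (at x)"
proof -
  \<comment> \<open>The half-line \<open>[d, \<infinity>)\<close> must contain 1, where the series converges, and \<open>x\<close> in its interior.\<close>
  define d where "d = min x 1 / 2"
  have d: "0 < d" "d < x" "d < 1" using x by (auto simp: d_def)
  have "uniformly_convergent_on {d..} (\<lambda>n x. \<Sum>i<n. log_factor_deriv p (real i + x))"
  proof (rule Weierstrass_m_test')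
    show "norm (log_factor_deriv p (real j + y)) \<le> \<bar>ln p\<bar> / (1 - p powr d) * p ^ j"
      if "y \<in> {d..}" for j y
      using abs_log_factor_deriv_le[of p d y j] that p d by simp
    show "summable (\<lambda>j. \<bar>ln p\<bar> / (1 - p powr d) * p ^ j)"
      using p by (intro summable_mult summable_geometric) auto
  qed
  moreover have "((\<lambda>y. ln (1 - p powr (real j + 1)) - ln (1 - p powr (real j + y)))
      has_real_derivative log_factor_deriv p (real j + y)) (at y within {d..})"
    if "y \<in> {d..}" for j y
    using that p d by (auto intro: has_field_derivative_at_within[OF DERIV_log_factor])
  moreover have "x \<in> interior {d..}" using d by (simp add: interior_real_atLeast)
  moreover have "1 \<in> {d..}" using d by simp
  moreover have "summable (\<lambda>j. ln (1 - p powr (real j + 1)) - ln (1 - p powr (real j + 1)))"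
    by simp
  ultimately show
    "summable (\<lambda>j. ln (1 - p powr (real j + 1)) - ln (1 - p powr (real j + x)))"
    "(log_q_prod p has_real_derivative log_q_prod_deriv p x) (at x)"
    using has_field_derivative_series'[of "{d..}"
        "\<lambda>j y. ln (1 - p powr (real j + 1)) - ln (1 - p powr (real j + y))"
        "\<lambda>j y. log_factor_deriv p (real j + y)" 1 x]
    unfolding log_q_prod_def[abs_def] log_q_prod_deriv_def by auto
qed

lemma q_prod_eq_exp:
  fixes p x :: real
  assumes p: "0 < p" "p < 1" and x: "0 < x"
  shows "(\<Prod>j. (1 - p powr (real j + 1)) / (1 - p powr (real j + x))) = exp (log_q_prod p x)"
proof -
  have "(1 - p powr (real j + 1)) / (1 - p powr (real j + x))
      = exp (ln (1 - p powr (real j + 1)) - ln (1 - p powr (real j + x)))" for j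
    using powr_lt_one[of p "real j + 1"] powr_lt_one[of p "real j + x"] p x by (simp add: exp_diff)
  then show ?thesis
    unfolding log_q_prod_def using prodinf_exp[OF summable_log_q_prod[OF assms]] by simp
qed

lemma log_q_prod_1: "log_q_prod p 1 = 0"
  by (simp add: log_q_prod_def)

text \<open>The series telescopes, and the factors \<open>1 - p\<^bsup>j+1\<^esup>\<close> tend to 1.\<close>

lemma log_q_prod_2:
  fixes p :: real
  assumes p: "0 < p" "p < 1"
  shows "log_q_prod p 2 = ln (1 - p)"
proof -
  define f where "f j = ln (1 - p powr (real j + 1))" for j
  have "(\<lambda>j. p ^ Suc j) \<longlonglongrightarrow> 0"
    using p by (intro LIMSEQ_Suc LIMSEQ_realpow_zero) auto
  moreover have "p ^ Suc j = p powr (real j + 1)" for j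
    using p powr_realpow[of p "Suc j"] by (simp add: add.commute)
  ultimately have "(\<lambda>j. p powr (real j + 1)) \<longlonglongrightarrow> 0" by simp
  then have "f \<longlonglongrightarrow> ln (1 - 0)"
    unfolding f_def by (intro tendsto_intros) auto
  then have "(\<lambda>j. f j - f (Suc j)) sums (f 0 - 0)"
    using telescope_sums'[of f 0] by simp
  then have "(\<Sum>j. f j - f (Suc j)) = ln (1 - p)"
    using p by (simp add: sums_iff f_def)
  moreover have "f (Suc j) = ln (1 - p powr (real j + 2))" for j
    by (simp add: f_def add_ac)
  ultimately show ?thesis by (simp add: log_q_prod_def f_def)
qed

lemma strict_mono_log_q_prod_deriv:
  fixes p x y :: real
  assumes "0 < p" "p < 1" "0 < x" "x < y"
  shows "log_q_prod_deriv p x < log_q_prod_deriv p y"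
proof -
  have "0 < (\<Sum>j. log_factor_deriv p (real j + y) - log_factor_deriv p (real j + x))"
    using assms by (intro suminf_pos summable_diff summable_log_factor_deriv)
      (auto intro: strict_mono_log_factor_deriv)
  also have "\<dots> = log_q_prod_deriv p y - log_q_prod_deriv p x"
    unfolding log_q_prod_deriv_def
    using assms by (intro suminf_diff[symmetric] summable_log_factor_deriv) auto
  finally show ?thesis by simp
qed

lemma concave_log_q_prod_deriv:
  fixes p :: real
  assumes p: "0 < p" "p < 1"
  shows "concave_on {0<..} (log_q_prod_deriv p)"
  unfolding concave_on_iff
proof (intro conjI ballI allI impI)
  fix x y u v :: real
  assume *: "x \<in> {0<..}" "y \<in> {0<..}" "0 \<le> u" "0 \<le> v" "u + v = 1"
  let ?z = "u *\<^sub>R x + v *\<^sub>R y"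
  have z: "0 < ?z"
    using convexD[of "{0<..}" x y u v] * by simp
  have sums: "summable (\<lambda>j. log_factor_deriv p (real j + w))" if "0 < w" for w
    using summable_log_factor_deriv p that by simp
  have "u * log_q_prod_deriv p x + v * log_q_prod_deriv p y
      = (\<Sum>j. u * log_factor_deriv p (real j + x) + v * log_factor_deriv p (real j + y))"
    unfolding log_q_prod_deriv_def using * sums
    by (subst suminf_add[symmetric]) (auto simp: suminf_mult summable_mult)
  also have "\<dots> \<le> log_q_prod_deriv p ?z"
    unfolding log_q_prod_deriv_def
  proof (intro suminf_le summable_add summable_mult sums)
    fix j :: nat
    have "u * (real j + x) + v * (real j + y) = (u + v) * real j + ?z"
      by (simp add: algebra_simps)
    then have "u *\<^sub>R (real j + x) + v *\<^sub>R (real j + y) = real j + ?z"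
      using * by simp
    then show "u * log_factor_deriv p (real j + x) + v * log_factor_deriv p (real j + y)
        \<le> log_factor_deriv p (real j + ?z)"
      using concave_log_factor_deriv[OF p] * unfolding concave_on_iff
      by (metis add_nonneg_pos greaterThan_iff of_nat_0_le_iff)
  qed (use * z in auto)
  finally show "u * log_q_prod_deriv p x + v * log_q_prod_deriv p y \<le> log_q_prod_deriv p ?z" .
qed auto

section \<open>The logarithm of the q-gamma function\<close>

text \<open>The common form of the three cases \<open>q < 1\<close>, \<open>q = 1\<close> and \<open>q > 1\<close>, with \<open>L = ln \<Gamma>\<^sub>q\<close> and
  \<open>D = \<psi>\<^sub>q\<close>; the logarithm turns the differentiation of a product into that of a series.\<close>

lemma q_gamma_logarithm:
  fixes q :: real
  assumes "q > 0"
  obtains L D where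
    "\<And>x. x > 0 \<Longrightarrow> q_gamma q x = exp (L x)"
    "\<And>x. x > 0 \<Longrightarrow> (L has_real_derivative D x) (at x)"
    "L 1 = 0" "L 2 = 0"
    "\<And>x y. 0 < x \<Longrightarrow> x < y \<Longrightarrow> D x < D y"
    "concave_on {0<..} D"
proof -
  consider "q < 1" | "q = 1" | "q > 1" by linarith
  then show thesis
  proof cases
    case 1
    define L where "L x = (1 - x) * ln (1 - q) + log_q_prod q x" for x
    define D where "D x = - ln (1 - q) + log_q_prod_deriv q x" for x
    show thesis
    proof (rule that[of L D])
      show "q_gamma q x = exp (L x)" if "x > 0" for x
        using q_prod_eq_exp[of q x] 1 assms that
        by (simp add: q_gamma_def L_def exp_add powr_def)
      show "(L has_real_derivative D x) (at x)" if "x > 0" for x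
        unfolding L_def D_def using 1 assms that
        by (auto intro!: derivative_eq_intros DERIV_log_q_prod)
      show "L 1 = 0" "L 2 = 0"
        using log_q_prod_2[of q] 1 assms by (simp_all add: L_def log_q_prod_1)
      show "D x < D y" if "0 < x" "x < y" for x y
        using strict_mono_log_q_prod_deriv[of q x y] 1 assms that by (simp add: D_def)
      show "concave_on {0<..} D"
        unfolding D_def using 1 assms
        by (intro concave_on_add concave_log_q_prod_deriv) (auto simp: concave_on_const)
    qed
  next
    case 2
    show thesis
    proof (rule that[of ln_Gamma Digamma])
      show "q_gamma q x = exp (ln_Gamma x)" if "x > 0" for x
        using that 2 by (simp add: q_gamma_def Gamma_real_pos_exp)
      show "(ln_Gamma has_real_derivative Digamma x) (at x)" if "x > 0" for x :: real
        using that by (rule has_field_derivative_ln_Gamma_real)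
      show "ln_Gamma (1::real) = 0" "ln_Gamma (2::real) = 0"
        using Gamma_numeral[of "num.Bit0 num.One", where 'a = real]
        by (simp_all add: ln_Gamma_real_pos)
      show "Digamma x < Digamma y" if "0 < x" "x < y" for x y :: real
        using that by (rule Digamma_real_strict_mono)
      show "concave_on {0<..} (Digamma :: real \<Rightarrow> real)"
      proof (rule f''_le0_imp_concave)
        fix x :: real
        assume x: "x \<in> {0<..}"
        then have nonpos: "x \<notin> \<int>\<^sub>\<le>\<^sub>0" by (auto elim!: nonpos_Ints_cases)
        show "(Digamma has_real_derivative Polygamma 1 x) (at x)"
          "(Polygamma 1 has_real_derivative Polygamma 2 x) (at x)"
          using nonpos by (auto intro!: derivative_eq_intros simp: numeral_2_eq_2)
        show "Polygamma 2 x \<le> 0"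
          using Polygamma_real_even_neg[of x 2] x by simp
      qed auto
    qed
  next
    case 3
    define p where "p = 1 / q"
    have p: "0 < p" "p < 1" using 3 by (auto simp: p_def)
    define L where
      "L x = (1 - x) * ln (q - 1) + x * (x - 1) / 2 * ln q + log_q_prod p x" for x
    define D where "D x = (- ln (q - 1) - ln q / 2) + (ln q * x + log_q_prod_deriv p x)" for x
    have "q powr (- t) = p powr t" for t
      using 3 by (simp add: p_def powr_divide powr_minus_divide)
    note powr_p = this
    show thesis
    proof (rule that[of L D])
      show "q_gamma q x = exp (L x)" if "x > 0" for x
        using q_prod_eq_exp[of p x] p 3 that
        unfolding q_gamma_def L_def powr_p
        by (simp add: exp_add powr_def)
      show "(L has_real_derivative D x) (at x)" if "x > 0" for x
        unfolding L_def D_def using p that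
        by (auto intro!: derivative_eq_intros DERIV_log_q_prod simp: field_simps)
      have "1 - p = (q - 1) / q" using 3 by (simp add: p_def field_simps)
      then have "ln (1 - p) = ln (q - 1) - ln q" using 3 by (simp add: ln_div)
      then show "L 1 = 0" "L 2 = 0"
        using log_q_prod_2[OF p] by (simp_all add: L_def log_q_prod_1)
      show "D x < D y" if "0 < x" "x < y" for x y
        unfolding D_def using p 3 that
        by (intro add_strict_left_mono add_strict_mono mult_strict_left_mono
            strict_mono_log_q_prod_deriv) auto
      have "concave_on {0<..} (\<lambda>x. ln q * x)"
        by (auto simp: concave_on_iff algebra_simps)
      then show "concave_on {0<..} D"
        unfolding D_def using p
        by (intro concave_on_add concave_log_q_prod_deriv) (auto simp: concave_on_const)
    qed
  qed
qed

section \<open>The q-digamma function\<close>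

lemma
  fixes q :: real
  assumes "q > 0"
  shows strict_mono_q_digamma: "\<And>x y. 0 < x \<Longrightarrow> x < y \<Longrightarrow> q_digamma q x < q_digamma q y"
    and concave_q_digamma: "concave_on {0<..} (q_digamma q)"
    and ex_q_digamma_zero: "\<exists>x. 1 < x \<and> x < 2 \<and> q_digamma q x = 0"
proof -
  obtain L D where exp: "\<And>x. x > 0 \<Longrightarrow> q_gamma q x = exp (L x)"
    and L: "\<And>x. x > 0 \<Longrightarrow> (L has_real_derivative D x) (at x)"
    and L12: "L 1 = 0" "L 2 = 0"
    and mono: "\<And>x y. 0 < x \<Longrightarrow> x < y \<Longrightarrow> D x < D y"
    and concave: "concave_on {0<..} D"
    using q_gamma_logarithm[OF assms] by metis
  have eq: "q_digamma q x = D x" if x: "x > 0" for x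
  proof -
    have "((\<lambda>x. exp (L x)) has_real_derivative exp (L x) * D x) (at x)"
      using L[OF x] by (auto intro!: derivative_eq_intros)
    then have "(q_gamma q has_real_derivative exp (L x) * D x) (at x)"
      by (rule has_field_derivative_transform_within_open[of _ _ _ "{0<..}"]) (use x exp in auto)
    then show ?thesis
      using exp[OF x] by (simp add: q_digamma_def DERIV_imp_deriv)
  qed
  show "q_digamma q x < q_digamma q y" if "0 < x" "x < y" for x y
    using that mono eq by simp
  have "convex {0::real<..}" by simp
  then have "u *\<^sub>R x + v *\<^sub>R y \<in> {0<..}"
    if "x \<in> {0<..}" "y \<in> {0<..}" "0 \<le> u" "0 \<le> v" "u + v = 1" for x y u v :: real
    using that by (rule convexD)
  then show "concave_on {0<..} (q_digamma q)"
    using concave eq unfolding concave_on_iff by simp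
  obtain z where "1 < z" "z < 2" "L 2 - L 1 = (2 - 1) * D z"
    using MVT2[of 1 2 L D] L by auto
  then show "\<exists>x. 1 < x \<and> x < 2 \<and> q_digamma q x = 0"
    using L12 eq by (intro exI[of _ z]) auto
qed

lemma
  fixes q :: real
  assumes "q > 0"
  shows q_digamma_zero_bounds: "1 < q_digamma_zero q" "q_digamma_zero q < 2"
    and q_digamma_pos: "\<And>x. q_digamma_zero q < x \<Longrightarrow> 0 < q_digamma q x"
proof -
  obtain z where z: "1 < z" "z < 2" "q_digamma q z = 0"
    using ex_q_digamma_zero[OF assms] by auto
  have "x = z" if "x > 0" "q_digamma q x = 0" for x
    using that z strict_mono_q_digamma[OF assms, of x z] strict_mono_q_digamma[OF assms, of z x]
    by (cases x z rule: linorder_cases) auto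
  then have "q_digamma_zero q = z"
    unfolding q_digamma_zero_def using z by (intro the_equality) auto
  then show "1 < q_digamma_zero q" "q_digamma_zero q < 2"
    "\<And>x. q_digamma_zero q < x \<Longrightarrow> 0 < q_digamma q x"
    using z strict_mono_q_digamma[OF assms, of z] by auto
qed

section \<open>Geometric means\<close>

lemma concave_on_geometric_mean_le:
  fixes f :: "real \<Rightarrow> real"
  assumes "concave_on S f" "x \<in> S" "y \<in> S" "0 < f x" "0 < f y" "0 \<le> u" "0 \<le> v" "u + v = 1"
  shows "f x powr u * f y powr v \<le> f (u * x + v * y)"
proof -
  have "f x powr u * f y powr v \<le> u * f x + v * f y"
    using assms by (intro Youngs_inequality_0) auto
  also have "\<dots> \<le> f (u * x + v * y)"
    using assms unfolding concave_on_iff by auto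
  finally show ?thesis .
qed

theorem corollary3:
  fixes q a :: real
  assumes "q > 0" and "a > 1"
  shows "(\<forall>x y. x > q_digamma_zero q \<and> y > q_digamma_zero q \<longrightarrow>
            q_digamma q x powr (1 / a) * q_digamma q y powr (1 - 1 / a)
              \<le> q_digamma q (x / a + (1 - 1 / a) * y)) \<and>
         (\<forall>u. u > - 2 / a + 1 \<and> a * (u - 1) + 2 > q_digamma_zero q \<longrightarrow>
            q_digamma q 2 powr (a - 1)
              \<le> q_digamma q (u + 1) powr a / q_digamma q (a * (u - 1) + 2))"
proof -
  note zero = q_digamma_zero_bounds[OF assms(1)] and pos = q_digamma_pos[OF assms(1)]
  have mean: "q_digamma q x powr (1 / a) * q_digamma q y powr (1 - 1 / a)
              \<le> q_digamma q (x / a + (1 - 1 / a) * y)"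
    if "x > q_digamma_zero q" "y > q_digamma_zero q" for x y
    using concave_on_geometric_mean_le[OF concave_q_digamma[OF assms(1)], of x y "1 / a" "1 - 1 / a"]
      that zero pos assms(2) by simp
  have "q_digamma q 2 powr (a - 1)
              \<le> q_digamma q (u + 1) powr a / q_digamma q (a * (u - 1) + 2)"
    if u: "a * (u - 1) + 2 > q_digamma_zero q" for u
  proof -
    let ?X = "q_digamma q (a * (u - 1) + 2)" and ?Y = "q_digamma q 2"
    have X: "?X > 0" and Y: "?Y > 0" using pos u zero by auto
    have "(a * (u - 1) + 2) / a + (1 - 1 / a) * 2 = u + 1"
      using assms(2) by (simp add: field_simps)
    then have "?X powr (1 / a) * ?Y powr (1 - 1 / a) \<le> q_digamma q (u + 1)"
      using mean[OF u zero(2)] by (simp only:)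
    then have "(?X powr (1 / a) * ?Y powr (1 - 1 / a)) powr a \<le> q_digamma q (u + 1) powr a"
      using assms(2) by (intro powr_mono2) auto
    also have "(?X powr (1 / a) * ?Y powr (1 - 1 / a)) powr a = ?X * ?Y powr (a - 1)"
      using X Y assms(2) by (simp add: powr_mult powr_powr algebra_simps)
    finally show ?thesis using X by (simp add: field_simps)
  qed
  then show ?thesis using mean by blast
qed

end
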